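(* Let $S$ be a multiset of $n$ positive integers and $t$ a positive integer. Partition $S$ into two halves $\ell_0$ and $\ell_1$, and let $U_0=|\Sigma(\ell_0)|$ and $U_1=|\Sigma(\ell_1)|$. There is a deterministic algorithm that solves Subset Sum on $(S,t)$ in time $O(\max(U_0,U_1)\cdot n^2)$ and space $O((U_0+U_1)\cdot n)$. There is also a randomized variant that solves it in expected time $O(\max(U_0,U_1)\cdot n)$ with the same space bound.
   Context: Subset Sum: given a multiset $S$ of positive integers and a target $t$, decide whether some submultiset of $S$ sums to $t$. For a multiset $A=\{a_1,\dots,a_m\}$, $\Sigma(A)=\{\sum_{i\in T}a_i : T\subseteq[m]\}$ is its set of distinct subset sums (including $0$). *)

theory Defs
  imports "HOL-Probability.Probability" "HOL-Library.Multiset"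
begin

section \<open>Subset Sum\<close>

definition subset_sum :: "nat multiset \<Rightarrow> nat \<Rightarrow> bool" where
  "subset_sum S t \<longleftrightarrow> (\<exists>T. T \<subseteq># S \<and> \<Sum>\<^sub># T = t)"

definition subset_sums :: "nat multiset \<Rightarrow> nat set" where
  "subset_sums A = {\<Sum>\<^sub># T | T. T \<subseteq># A}"

text \<open>
  The sums over submultisets are the sums over index sets of any enumeration.
\<close>

lemma subset_sums_mset:
  "subset_sums (mset xs) = {(\<Sum>i\<in>T. xs ! i) | T. T \<subseteq> {..<length xs}}"
proof -
  have mx: "mset xs = image_mset ((!) xs) (mset_set {..<length xs})"
    by (metis lessThan_atLeast0 map_nth mset_map mset_upt)
  show ?thesis
  proof (intro set_eqI iffI)
    fix s assume "s \<in> subset_sums (mset xs)"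
    then obtain T where T: "T \<subseteq># image_mset ((!) xs) (mset_set {..<length xs})" "s = \<Sum>\<^sub># T"
      by (auto simp: subset_sums_def mx)
    then obtain B where B: "B \<subseteq># mset_set {..<length xs}" "T = image_mset ((!) xs) B"
      by (metis mset_subset_eq_exists_conv image_mset_eq_plusD subset_mset.le_iff_add)
    have "B = mset_set (set_mset B)"
    proof (rule multiset_eqI)
      fix x
      have "count B x \<le> 1"
        using mset_subset_eq_count[OF B(1), of x]
        by (metis count_mset_set' le_trans order_refl zero_le_one)
      then show "count B x = count (mset_set (set_mset B)) x"
        by (cases "x \<in># B") (auto simp: le_Suc_eq count_eq_zero_iff)
    qed
    moreover have "set_mset B \<subseteq> {..<length xs}"
      using set_mset_mono[OF B(1)] by simp
    ultimately show "s \<in> {(\<Sum>i\<in>T. xs ! i) | T. T \<subseteq> {..<length xs}}"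
      using T(2) B(2) by (metis (mono_tags, lifting) mem_Collect_eq sum_unfold_sum_mset)
  next
    fix s assume "s \<in> {(\<Sum>i\<in>T. xs ! i) | T. T \<subseteq> {..<length xs}}"
    then obtain T where T: "T \<subseteq> {..<length xs}" "s = \<Sum>\<^sub># (image_mset ((!) xs) (mset_set T))"
      by (auto simp: sum_unfold_sum_mset)
    then have "image_mset ((!) xs) (mset_set T) \<subseteq># mset xs"
      unfolding mx by (intro image_mset_subseteq_mono subset_imp_msubset_mset_set) auto
    then show "s \<in> subset_sums (mset xs)"
      using T(2) by (auto simp: subset_sums_def)
  qed
qed

text \<open>
  The input of an algorithm is a list \<open>xs\<close> enumerating the multiset. The two halves are its first
  \<open>\<lfloor>n/2\<rfloor>\<close> entries and the remaining \<open>\<lceil>n/2\<rceil>\<close> ones, named in either order. As the enumeration is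
  arbitrary, so is the balanced partition; see \<open>ex_enumeration_halves\<close>.
\<close>

definition halves :: "nat list \<Rightarrow> nat multiset \<Rightarrow> nat multiset \<Rightarrow> bool" where
  "halves xs l0 l1 \<longleftrightarrow>
     (let h = length xs div 2; a = mset (take h xs); b = mset (drop h xs)
      in l0 = a \<and> l1 = b \<or> l0 = b \<and> l1 = a)"

lemma ex_enumeration_halves:
  assumes "S = l0 + l1" "size l0 \<le> size l1 + 1" "size l1 \<le> size l0 + 1"
  shows "\<exists>xs. mset xs = S \<and> halves xs l0 l1"
proof -
  obtain ys zs where l: "mset ys = l0" "mset zs = l1"
    using ex_mset by metis
  then have len: "length ys \<le> length zs + 1" "length zs \<le> length ys + 1"
    using assms by auto
  show ?thesis
  proof (cases "length ys \<le> length zs")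
    case True
    then have "length (ys @ zs) div 2 = length ys" using len by simp
    then show ?thesis
      using l assms(1) by (intro exI[of _ "ys @ zs"]) (simp add: halves_def)
  next
    case False
    then have "length (zs @ ys) div 2 = length zs" using len by simp
    then show ?thesis
      using l assms(1) by (intro exI[of _ "zs @ ys"]) (simp add: halves_def)
  qed
qed


section \<open>Word RAM\<close>

text \<open>
  A uniform-cost random access machine with words of \<open>w\<close> bits, that is, numbers below \<open>2 ^ w\<close>.
  A program does not depend on \<open>w\<close>. It names finitely many registers and addresses the memory
  indirectly through them. All arithmetic is modulo \<open>2 ^ w\<close>. \<open>Rand\<close> draws a uniformly random word.
\<close>

datatype binop =
  Op_add | Op_sub | Op_mul | Op_div | Op_mod | Op_and | Op_or | Op_xor | Op_shl | Op_shr

datatype instr =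
    Const nat nat           \<comment> \<open>\<open>Const r v\<close>: \<open>R[r] := v\<close>\<close>
  | Binop binop nat nat nat \<comment> \<open>\<open>Binop f r p q\<close>: \<open>R[r] := f R[p] R[q]\<close>\<close>
  | Load nat nat            \<comment> \<open>\<open>Load r p\<close>: \<open>R[r] := M[R[p]]\<close>\<close>
  | Store nat nat           \<comment> \<open>\<open>Store p r\<close>: \<open>M[R[p]] := R[r]\<close>\<close>
  | Rand nat
  | Jump nat
  | Jump_less nat nat nat   \<comment> \<open>\<open>Jump_less p q l\<close>: go to \<open>l\<close> if \<open>R[p] < R[q]\<close>\<close>
  | Jump_eq nat nat nat
  | Halt bool

type_synonym program = "instr list"

record config =
  pc :: nat
  regs :: "nat \<Rightarrow> nat"
  mem :: "nat \<Rightarrow> nat"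

context
  includes bit_operations_syntax
begin

fun apply_binop :: "binop \<Rightarrow> nat \<Rightarrow> nat \<Rightarrow> nat \<Rightarrow> nat" where
  "apply_binop Op_add w a b = (a + b) mod 2 ^ w"
| "apply_binop Op_sub w a b = (a + 2 ^ w - b) mod 2 ^ w"
| "apply_binop Op_mul w a b = (a * b) mod 2 ^ w"
| "apply_binop Op_div w a b = a div b"
| "apply_binop Op_mod w a b = a mod b"
| "apply_binop Op_and w a b = a AND b"
| "apply_binop Op_or w a b = a OR b"
| "apply_binop Op_xor w a b = a XOR b"
| "apply_binop Op_shl w a b = push_bit b a mod 2 ^ w"
| "apply_binop Op_shr w a b = drop_bit b a"

end

definition set_reg :: "nat \<Rightarrow> nat \<Rightarrow> config \<Rightarrow> config" where
  "set_reg r v c = c\<lparr>pc := Suc (pc c), regs := (regs c)(r := v)\<rparr>"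

text \<open>The argument \<open>z\<close> is the random word available to the instruction.\<close>

fun exec :: "nat \<Rightarrow> nat \<Rightarrow> instr \<Rightarrow> config \<Rightarrow> config" where
  "exec w z (Const r v) c = set_reg r (v mod 2 ^ w) c"
| "exec w z (Binop f r p q) c = set_reg r (apply_binop f w (regs c p) (regs c q)) c"
| "exec w z (Load r p) c = set_reg r (mem c (regs c p)) c"
| "exec w z (Store p r) c =
     c\<lparr>pc := Suc (pc c), mem := (mem c)(regs c p := regs c r)\<rparr>"
| "exec w z (Rand r) c = set_reg r (z mod 2 ^ w) c"
| "exec w z (Jump l) c = c\<lparr>pc := l\<rparr>"
| "exec w z (Jump_less p q l) c =
     c\<lparr>pc := if regs c p < regs c q then l else Suc (pc c)\<rparr>"
| "exec w z (Jump_eq p q l) c =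
     c\<lparr>pc := if regs c p = regs c q then l else Suc (pc c)\<rparr>"
| "exec w z (Halt b) c = c"

text \<open>
  Only \<open>Halt\<close> ends a computation; a program counter outside the program means divergence.
\<close>

definition step :: "nat \<Rightarrow> program \<Rightarrow> nat \<Rightarrow> config \<Rightarrow> config" where
  "step w P z c = (if pc c < length P then exec w z (P ! pc c) c else c)"

text \<open>
  A random tape \<open>\<omega>\<close> provides an independent word for every step, whether or not it is used.
\<close>

primrec run :: "nat \<Rightarrow> program \<Rightarrow> (nat \<Rightarrow> nat) \<Rightarrow> config \<Rightarrow> nat \<Rightarrow> config" where
  "run w P \<omega> c 0 = c"
| "run w P \<omega> c (Suc k) = step w P (\<omega> k) (run w P \<omega> c k)"

definition halted :: "program \<Rightarrow> config \<Rightarrow> bool \<Rightarrow> bool" where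
  "halted P c b \<longleftrightarrow> pc c < length P \<and> P ! pc c = Halt b"

definition outputs :: "nat \<Rightarrow> program \<Rightarrow> (nat \<Rightarrow> nat) \<Rightarrow> config \<Rightarrow> bool \<Rightarrow> bool" where
  "outputs w P \<omega> c b \<longleftrightarrow> (\<exists>k. halted P (run w P \<omega> c k) b)"

text \<open>
  The number of executed instructions, including \<open>Halt\<close>; it is \<open>\<infinity>\<close> if the computation diverges.
\<close>

definition run_time :: "nat \<Rightarrow> program \<Rightarrow> (nat \<Rightarrow> nat) \<Rightarrow> config \<Rightarrow> enat" where
  "run_time w P \<omega> c = (INF k \<in> {k. \<exists>b. halted P (run w P \<omega> c k) b}. enat (Suc k))"

definition accessed :: "program \<Rightarrow> config \<Rightarrow> nat set" where
  "accessed P c =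
     (if pc c < length P
      then (case P ! pc c of Load r p \<Rightarrow> {regs c p} | Store p r \<Rightarrow> {regs c p} | _ \<Rightarrow> {})
      else {})"

text \<open>
  Space is the length of the shortest initial segment of the memory containing every cell read or
  written. Counting distinct cells instead would make sparse tables indexed by numbers
  of size \<open>2 ^ w\<close> cheap. The registers, constantly many for a fixed program, are not counted.
\<close>

definition run_space :: "nat \<Rightarrow> program \<Rightarrow> (nat \<Rightarrow> nat) \<Rightarrow> config \<Rightarrow> enat" where
  "run_space w P \<omega> c = (SUP k. SUP a \<in> accessed P (run w P \<omega> c k). enat (Suc a))"

definition deterministic :: "program \<Rightarrow> bool" where
  "deterministic P \<longleftrightarrow> (\<forall>r. Rand r \<notin> set P)"

definition random_tape :: "nat \<Rightarrow> (nat \<Rightarrow> nat) measure" where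
  "random_tape w = (\<Pi>\<^sub>M i\<in>UNIV. measure_pmf (pmf_of_set {..<2 ^ w}))"

text \<open>An instance is stored as \<open>n\<close>, \<open>t\<close> and the \<open>n\<close> numbers, from address 0 on.\<close>

definition init_config :: "nat list \<Rightarrow> nat \<Rightarrow> config" where
  "init_config xs t =
     \<lparr>pc = 0, regs = (\<lambda>_. 0),
      mem = (\<lambda>a. if a < length xs + 2 then (length xs # t # xs) ! a else 0)\<rparr>"

text \<open>
  The word-size convention: a word holds the target and every subset sum, and it can address \<open>m\<close>
  memory cells. In the theorem, \<open>m\<close> is the space bound.
\<close>

definition fits_words :: "nat \<Rightarrow> nat multiset \<Rightarrow> nat \<Rightarrow> nat \<Rightarrow> bool" where
  "fits_words w S t m \<longleftrightarrow> t < 2 ^ w \<and> \<Sum>\<^sub># S < 2 ^ w \<and> m \<le> 2 ^ w"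

end

theory Submission
  imports Defs
begin

text \<open>
  One deterministic program meets both bounds, since hashing is unnecessary. If \<open>L\<close> lists the
  subset sums of \<open>A\<close> in increasing order, then merging \<open>L\<close> with \<open>L + a\<close> lists those of
  \<open>A \<union> {a}\<close> in time linear in the length of \<open>L\<close>, which never exceeds the final length. Both halves
  are thus enumerated in time \<open>O(max U\<^sub>0 U\<^sub>1 \<cdot> n)\<close>. Writing every list behind the
  previous one costs \<open>O((U\<^sub>0 + U\<^sub>1) \<cdot> n)\<close> cells. A two-pointer search, increasing in one
  list and decreasing in the other, then finds a pair with sum \<open>t\<close>.
\<close>

section \<open>Sorted lists of subset sums\<close>

lemma subset_sums_empty [simp]: "subset_sums {#} = {0}"
  by (auto simp: subset_sums_def)

text \<open>A submultiset containing \<open>a\<close> is \<open>add_mset a\<close> of a submultiset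
  of \<open>A\<close>; one avoiding \<open>a\<close> already lies in \<open>A\<close>.\<close>

lemma subset_sums_add_mset:
  "subset_sums (add_mset a A) = subset_sums A \<union> (+) a ` subset_sums A"
proof (intro set_eqI iffI)
  fix s assume "s \<in> subset_sums (add_mset a A)"
  then obtain T where T: "T \<subseteq># add_mset a A" "s = \<Sum>\<^sub># T"
    by (auto simp: subset_sums_def)
  show "s \<in> subset_sums A \<union> (+) a ` subset_sums A"
  proof (cases "a \<in># T")
    case True
    then obtain T' where "T = add_mset a T'" by (metis insert_DiffM)
    then show ?thesis using T by (auto simp: subset_sums_def)
  next
    case False
    from T(1) have "T - {#a#} \<subseteq># A" by (simp add: subset_eq_diff_conv)
    then have "T \<subseteq># A" by (simp only: diff_single_trivial[OF False])
    then show ?thesis using T by (auto simp: subset_sums_def)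
  qed
next
  fix s assume "s \<in> subset_sums A \<union> (+) a ` subset_sums A"
  then obtain T where T: "T \<subseteq># A" "s = \<Sum>\<^sub># T \<or> s = \<Sum>\<^sub># (add_mset a T)"
    by (auto simp: subset_sums_def)
  then have "T \<subseteq># add_mset a A" "add_mset a T \<subseteq># add_mset a A"
    by (auto intro: subset_mset.order_trans[of T A])
  with T(2) show "s \<in> subset_sums (add_mset a A)"
    unfolding subset_sums_def by blast
qed

text \<open>A submultiset \<open>T\<close> of \<open>A + B\<close> splits into
  \<open>T \<inter># A\<close> and \<open>T - A\<close>; whatever \<open>A\<close> cannot supply
  must come from \<open>B\<close>.\<close>

lemma subset_sum_union_iff:
  "subset_sum (A + B) t \<longleftrightarrow> (\<exists>x\<in>subset_sums A. \<exists>y\<in>subset_sums B. x + y = t)"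
proof
  assume "subset_sum (A + B) t"
  then obtain T where T: "T \<subseteq># A + B" "\<Sum>\<^sub># T = t"
    by (auto simp: subset_sum_def)
  have "T - A \<subseteq># B" using T(1) by (simp add: subset_eq_diff_conv add.commute)
  moreover have "T \<inter># A + (T - A) = T"
    by (simp add: multiset_eq_iff min_def)
  ultimately have "\<Sum>\<^sub># (T \<inter># A) \<in> subset_sums A" "\<Sum>\<^sub># (T - A) \<in> subset_sums B"
    "\<Sum>\<^sub># (T \<inter># A) + \<Sum>\<^sub># (T - A) = t"
    using T(2) by (auto simp: subset_sums_def simp flip: sum_mset.union)
  then show "\<exists>x\<in>subset_sums A. \<exists>y\<in>subset_sums B. x + y = t"
    by blast
next
  assume "\<exists>x\<in>subset_sums A. \<exists>y\<in>subset_sums B. x + y = t"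
  then obtain X Y where "X \<subseteq># A" "Y \<subseteq># B" "\<Sum>\<^sub># X + \<Sum>\<^sub># Y = t"
    by (auto simp: subset_sums_def)
  then show "subset_sum (A + B) t"
    unfolding subset_sum_def by (intro exI[of _ "X + Y"]) (auto intro: subset_mset.add_mono)
qed

lemma subset_sums_le: "s \<in> subset_sums A \<Longrightarrow> s \<le> \<Sum>\<^sub># A"
  by (auto simp: subset_sums_def elim!: mset_subset_eq_exists_conv[THEN iffD1, THEN exE])

text \<open>
  The merge stops when its second argument is exhausted; in the merge of \<open>L\<close> and \<open>L + a\<close> the
  first one is exhausted before.
\<close>

fun merge_lists :: "nat list \<Rightarrow> nat list \<Rightarrow> nat list" where
  "merge_lists xs [] = []"
| "merge_lists [] (y # ys) = y # merge_lists [] ys"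
| "merge_lists (x # xs) (y # ys) =
     (if x < y then x # merge_lists xs (y # ys)
      else if x = y then merge_lists xs (y # ys)
      else y # merge_lists (x # xs) ys)"

text \<open>The third hypothesis makes stopping at the end of \<open>ys\<close> lossless: it forces
  \<open>xs\<close> to be empty when \<open>ys\<close> is. A tie drops \<open>x\<close> but keeps
  \<open>y\<close>, so the common value is still emitted.\<close>

lemma set_merge_lists:
  assumes "sorted_wrt (<) xs" "sorted_wrt (<) ys" "\<forall>x\<in>set xs. \<exists>y\<in>set ys. x \<le> y"
  shows "set (merge_lists xs ys) = set xs \<union> set ys"
  using assms
proof (induction xs ys rule: merge_lists.induct)
  case (3 x xs y ys)
  consider "x < y" | "x = y" | "y < x" by linarith
  then show ?case
  proof cases
    case 3
    \<comment> \<open>As \<open>y < x\<close>, the entry \<open>y\<close> dominates neither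
      \<open>x\<close> nor the larger entries behind it, so the hypothesis survives its
      removal.\<close>
    then have "\<forall>z\<in>set (x # xs). \<exists>u\<in>set ys. z \<le> u"
      using "3.prems" by fastforce
    then show ?thesis using 3 "3.IH" "3.prems" by auto
  qed (use 3 in auto)
qed auto

text \<open>Each emitted head lies strictly below everything still to come, whose set is known from
  \<open>set_merge_lists\<close>; a tie emits nothing.\<close>

lemma sorted_merge_lists:
  assumes "sorted_wrt (<) xs" "sorted_wrt (<) ys" "\<forall>x\<in>set xs. \<exists>y\<in>set ys. x \<le> y"
  shows "sorted_wrt (<) (merge_lists xs ys)"
  using assms
proof (induction xs ys rule: merge_lists.induct)
  case (2 y ys)
  then show ?case using set_merge_lists[of "[]" ys] by auto
next
  case (3 x xs y ys)
  consider "x < y" | "x = y" | "y < x" by linarith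
  then show ?case
  proof cases
    case 1
    moreover have "set (merge_lists xs (y # ys)) = set xs \<union> set (y # ys)"
      using "3.prems" by (intro set_merge_lists) auto
    ultimately show ?thesis using "3.IH"(1) "3.prems" by auto
  next
    case 2
    then show ?thesis using 3 by auto
  next
    case 3
    then have "\<forall>z\<in>set (x # xs). \<exists>u\<in>set ys. z \<le> u"
      using "3.prems" by fastforce
    moreover from this have "set (merge_lists (x # xs) ys) = set (x # xs) \<union> set ys"
      using "3.prems" by (intro set_merge_lists) auto
    ultimately show ?thesis using 3 "3.IH" "3.prems" by auto
  qed
qed auto

definition add_elem :: "nat list \<Rightarrow> nat \<Rightarrow> nat list" where
  "add_elem L a = merge_lists L (map ((+) a) L)"

text \<open>Each \<open>x\<close> in \<open>L\<close> is dominated by \<open>a + x\<close>, so the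
  merge loses nothing.\<close>

lemma
  assumes "sorted_wrt (<) L"
  shows set_add_elem: "set (add_elem L a) = set L \<union> (+) a ` set L"
    and sorted_add_elem: "sorted_wrt (<) (add_elem L a)"
proof -
  have "sorted_wrt (<) (map ((+) a) L)"
    using assms by (simp add: sorted_wrt_map)
  moreover have "\<forall>x\<in>set L. \<exists>y\<in>set (map ((+) a) L). x \<le> y"
    by force
  ultimately show "set (add_elem L a) = set L \<union> (+) a ` set L"
    and "sorted_wrt (<) (add_elem L a)"
    unfolding add_elem_def using assms by (simp_all only: set_merge_lists sorted_merge_lists list.set_map)
qed

lemma sorted_foldl_add_elem:
  "sorted_wrt (<) L \<Longrightarrow> sorted_wrt (<) (foldl add_elem L zs)"
  by (induction zs arbitrary: L) (auto simp: sorted_add_elem)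

lemma set_foldl_add_elem_mono:
  "sorted_wrt (<) L \<Longrightarrow> set L \<subseteq> set (foldl add_elem L zs)"
proof (induction zs arbitrary: L)
  case (Cons a zs)
  then show ?case using Cons.IH[of "add_elem L a"] by (auto simp: sorted_add_elem set_add_elem)
qed simp

lemma length_sorted_eq_card: "sorted_wrt (<) (L :: nat list) \<Longrightarrow> length L = card (set L)"
  by (simp add: distinct_card strict_sorted_iff)

text \<open>This lets the final number of subset sums bound every intermediate list, and hence the
  cost of each merge.\<close>

lemma length_foldl_add_elem_mono:
  "sorted_wrt (<) L \<Longrightarrow> length L \<le> length (foldl add_elem L zs)"
  by (simp add: length_sorted_eq_card sorted_foldl_add_elem card_mono set_foldl_add_elem_mono)

lemma set_foldl_add_elem:
  "set (foldl add_elem [0] zs) = subset_sums (mset zs)"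
proof (induction zs rule: rev_induct)
  case (snoc a zs)
  then show ?case by (simp add: set_add_elem sorted_foldl_add_elem subset_sums_add_mset)
qed simp


section \<open>Deterministic computations\<close>

definition access_below :: "nat \<Rightarrow> program \<Rightarrow> config \<Rightarrow> bool" where
  "access_below B P c \<longleftrightarrow> accessed P c \<subseteq> {..<B}"

text \<open>Answer, time and space are combined in one predicate, recursive in the time budget so
  that rewriting executes a program symbolically. Budget \<open>0\<close> fails, so the final
  \<open>Halt\<close> is counted.\<close>

primrec halts_within :: "nat \<Rightarrow> program \<Rightarrow> nat \<Rightarrow> nat \<Rightarrow> config \<Rightarrow> bool \<Rightarrow> bool" where
  "halts_within w P B 0 c b = False"
| "halts_within w P B (Suc T) c b =
     (halted P c b \<or> access_below B P c \<and> halts_within w P B T (step w P 0 c) b)"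

text \<open>With a budget of a literal plus a symbolic rest \<open>T\<close>, a straight-line
  segment consumes the literal and leaves \<open>T\<close> for what follows.\<close>

lemma halts_within_numeral:
  "halts_within w P B (numeral k + T) c b =
     (halted P c b \<or> access_below B P c \<and>
        halts_within w P B (pred_numeral k + T) (step w P 0 c) b)"
  by (simp add: numeral_eq_Suc)

lemma halts_within_mono: "halts_within w P B T c b \<Longrightarrow> T \<le> T' \<Longrightarrow> halts_within w P B T' c b"
proof (induction T arbitrary: T' c)
  case (Suc T)
  then show ?case by (cases T') auto
qed simp

lemma halts_within_sound:
  assumes "halts_within w P B T c b"
  obtains k where "k < T" "halted P ((step w P 0 ^^ k) c) b"
    "\<And>j. j < k \<Longrightarrow> access_below B P ((step w P 0 ^^ j) c)"
proof -
  have "\<exists>k<T. halted P ((step w P 0 ^^ k) c) b \<and>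
      (\<forall>j<k. access_below B P ((step w P 0 ^^ j) c))"
    using assms
  proof (induction T arbitrary: c)
    case (Suc T)
    show ?case
    proof (cases "halted P c b")
      case True
      then show ?thesis by (intro exI[of _ 0]) auto
    next
      case False
      with Suc.prems have a: "access_below B P c" "halts_within w P B T (step w P 0 c) b"
        by auto
      from Suc.IH[OF a(2)] obtain k where k: "k < T"
        "halted P ((step w P 0 ^^ k) (step w P 0 c)) b"
        "\<forall>j<k. access_below B P ((step w P 0 ^^ j) (step w P 0 c))" by auto
      have "access_below B P ((step w P 0 ^^ j) c)" if "j < Suc k" for j
        using that a(1) k(3) by (cases j) (auto simp: funpow_swap1)
      then show ?thesis
        using k by (intro exI[of _ "Suc k"]) (auto simp: funpow_swap1)
    qed
  qed simp
  then show ?thesis using that by auto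
qed

text \<open>Only \<open>Rand\<close> reads the random word.\<close>

lemma step_deterministic:
  assumes "deterministic P"
  shows "step w P z c = step w P 0 c"
proof (cases "pc c < length P")
  case True
  then have "P ! pc c \<in> set P" by simp
  then have "\<forall>r. P ! pc c \<noteq> Rand r" using assms by (metis deterministic_def)
  then show ?thesis by (cases "P ! pc c") (auto simp: step_def)
qed (simp add: step_def)

lemma run_deterministic:
  assumes "deterministic P"
  shows "run w P \<omega> c k = (step w P 0 ^^ k) c"
  by (induction k) (auto simp: step_deterministic[OF assms, of w "\<omega> _"])

lemma halts_within_run:
  assumes det: "deterministic P" and h: "halts_within w P B T c b"
  shows "outputs w P \<omega> c b" "run_time w P \<omega> c \<le> enat T" "run_space w P \<omega> c \<le> enat B"
proof -
  from h obtain k where k: "k < T" "halted P (run w P \<omega> c k) b"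
    "\<And>j. j < k \<Longrightarrow> access_below B P (run w P \<omega> c j)"
    by (rule halts_within_sound) (auto simp: run_deterministic[OF det])
  show "outputs w P \<omega> c b" using k(2) by (auto simp: outputs_def)
  have "run_time w P \<omega> c \<le> enat (Suc k)"
    unfolding run_time_def by (rule INF_lower) (use k(2) in auto)
  then show "run_time w P \<omega> c \<le> enat T" using k(1) by (meson Suc_leI enat_ord_simps(1) order_trans)
  \<comment> \<open>\<open>Halt\<close> fixes the configuration and accesses no cell, so the
    supremum over all times in \<open>run_space\<close> gains nothing from time \<open>k\<close>
    on.\<close>
  have after: "run w P \<omega> c (k + j) = run w P \<omega> c k" for j
    by (induction j) (use k(2) in \<open>auto simp: step_def halted_def\<close>)
  have "access_below B P (run w P \<omega> c j)" for j
  proof (cases "j < k")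
    case False
    then have "run w P \<omega> c j = run w P \<omega> c k" using after[of "j - k"] by simp
    then show ?thesis using k(2) by (auto simp: access_below_def accessed_def halted_def)
  qed (use k in auto)
  then show "run_space w P \<omega> c \<le> enat B"
    unfolding run_space_def by (intro SUP_least) (auto simp: access_below_def Suc_le_eq)
qed


section \<open>The word RAM program\<close>

text \<open>
  Registers: \<open>0\<close> and \<open>1\<close> hold the constants \<open>0\<close> and \<open>1\<close>; \<open>2\<close> the end of the input; \<open>3\<close> the
  target; \<open>4\<close> the first free cell, which is the end of the current list; \<open>5\<close> the start of the
  current list; \<open>6\<close> the input pointer; \<open>7\<close> the start of the second half, or \<open>0\<close> once it has been
  reached; \<open>8\<close> the element being added; \<open>9\<close>, \<open>10\<close> and \<open>11\<close> the two merge pointers and their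
  common limit; \<open>14\<close> and \<open>15\<close> the start and the end of the list of the first half.

  Entry points: \<open>8\<close> start of a list, \<open>11\<close> loop over the input, \<open>18\<close> merge loop, \<open>35\<close> end of
  the first half, \<open>39\<close> two-pointer search.
\<close>

definition solver :: program where
  "solver =
    [Const 1 1, Load 2 0, Load 3 1, Const 6 2, Binop Op_shr 7 2 1, Binop Op_add 7 7 6,
     Binop Op_add 2 2 6, Binop Op_add 4 2 0,
     Binop Op_add 5 4 0, Store 4 0, Binop Op_add 4 4 1,
     Jump_eq 6 7 35, Jump_eq 6 2 39,
     Load 8 6, Binop Op_add 6 6 1, Binop Op_add 9 5 0, Binop Op_add 10 5 0,
     Binop Op_add 11 4 0,
     Jump_eq 10 11 33, Load 13 10, Binop Op_add 13 13 8, Jump_eq 9 11 25, Load 12 9,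
     Jump_less 12 13 29, Jump_eq 12 13 31,
     Store 4 13, Binop Op_add 4 4 1, Binop Op_add 10 10 1, Jump 18,
     Store 4 12, Binop Op_add 4 4 1, Binop Op_add 9 9 1, Jump 18,
     Binop Op_add 5 11 0, Jump 11,
     Binop Op_add 14 5 0, Binop Op_add 15 4 0, Const 7 0, Jump 8,
     Jump_eq 14 15 52, Jump_eq 4 5 52, Binop Op_sub 9 4 1, Load 12 14, Load 13 9,
     Binop Op_add 12 12 13, Jump_eq 12 3 51, Jump_less 12 3 49, Binop Op_add 4 9 0, Jump 39,
     Binop Op_add 14 14 1, Jump 39,
     Halt True, Halt False]"

text \<open>One rewrite rule per program counter keeps symbolic execution from unfolding the whole
  list.\<close>

lemma solver_nth:
  "solver ! 0 = Const 1 1"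
  "solver ! Suc 0 = Load 2 0"
  "solver ! 2 = Load 3 1"
  "solver ! 3 = Const 6 2"
  "solver ! 4 = Binop Op_shr 7 2 1"
  "solver ! 5 = Binop Op_add 7 7 6"
  "solver ! 6 = Binop Op_add 2 2 6"
  "solver ! 7 = Binop Op_add 4 2 0"
  "solver ! 8 = Binop Op_add 5 4 0"
  "solver ! 9 = Store 4 0"
  "solver ! 10 = Binop Op_add 4 4 1"
  "solver ! 11 = Jump_eq 6 7 35"
  "solver ! 12 = Jump_eq 6 2 39"
  "solver ! 13 = Load 8 6"
  "solver ! 14 = Binop Op_add 6 6 1"
  "solver ! 15 = Binop Op_add 9 5 0"
  "solver ! 16 = Binop Op_add 10 5 0"
  "solver ! 17 = Binop Op_add 11 4 0"
  "solver ! 18 = Jump_eq 10 11 33"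
  "solver ! 19 = Load 13 10"
  "solver ! 20 = Binop Op_add 13 13 8"
  "solver ! 21 = Jump_eq 9 11 25"
  "solver ! 22 = Load 12 9"
  "solver ! 23 = Jump_less 12 13 29"
  "solver ! 24 = Jump_eq 12 13 31"
  "solver ! 25 = Store 4 13"
  "solver ! 26 = Binop Op_add 4 4 1"
  "solver ! 27 = Binop Op_add 10 10 1"
  "solver ! 28 = Jump 18"
  "solver ! 29 = Store 4 12"
  "solver ! 30 = Binop Op_add 4 4 1"
  "solver ! 31 = Binop Op_add 9 9 1"
  "solver ! 32 = Jump 18"
  "solver ! 33 = Binop Op_add 5 11 0"
  "solver ! 34 = Jump 11"
  "solver ! 35 = Binop Op_add 14 5 0"
  "solver ! 36 = Binop Op_add 15 4 0"
  "solver ! 37 = Const 7 0"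
  "solver ! 38 = Jump 8"
  "solver ! 39 = Jump_eq 14 15 52"
  "solver ! 40 = Jump_eq 4 5 52"
  "solver ! 41 = Binop Op_sub 9 4 1"
  "solver ! 42 = Load 12 14"
  "solver ! 43 = Load 13 9"
  "solver ! 44 = Binop Op_add 12 12 13"
  "solver ! 45 = Jump_eq 12 3 51"
  "solver ! 46 = Jump_less 12 3 49"
  "solver ! 47 = Binop Op_add 4 9 0"
  "solver ! 48 = Jump 39"
  "solver ! 49 = Binop Op_add 14 14 1"
  "solver ! 50 = Jump 39"
  "solver ! 51 = Halt True"
  "solver ! 52 = Halt False"
  by (simp_all add: solver_def)

lemma length_solver: "length solver = 53"
  by (simp add: solver_def)

lemma deterministic_solver: "deterministic solver"
  by (simp add: deterministic_def solver_def)

text \<open>A literal program counter \<open>2\<close> arises as \<open>Suc (Suc 0)\<close>, which \<open>simp\<close> leaves alone.\<close>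

lemmas solver_exec = halts_within_numeral halted_def access_below_def accessed_def step_def
  set_reg_def solver_nth length_solver numeral_2_eq_2[symmetric]

section \<open>Lists stored in memory\<close>

primrec array :: "(nat \<Rightarrow> nat) \<Rightarrow> nat \<Rightarrow> nat list \<Rightarrow> bool" where
  "array M p [] = True"
| "array M p (x # xs) = (M p = x \<and> array M (Suc p) xs)"

lemma array_iff_nth: "array M p xs \<longleftrightarrow> (\<forall>i<length xs. M (p + i) = xs ! i)"
  by (induction xs arbitrary: p) (auto simp: All_less_Suc2)

lemma array_append: "array M p (xs @ ys) \<longleftrightarrow> array M p xs \<and> array M (p + length xs) ys"
  by (induction xs arbitrary: p) auto

lemma array_cong:
  "(\<And>k. p \<le> k \<Longrightarrow> k < p + length xs \<Longrightarrow> M k = M' k) \<Longrightarrow> array M p xs = array M' p xs"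
  by (simp add: array_iff_nth)

lemma array_update_above: "p + length xs \<le> k \<Longrightarrow> array (M(k := v)) p xs = array M p xs"
  by (rule array_cong) auto

section \<open>The two-pointer search\<close>

text \<open>Loop invariant: \<open>xs\<close> and \<open>ys\<close> are the candidates left, the
  first read at \<open>R 14\<close>, the second from its end \<open>R 4\<close>. An unsuccessful
  round discards one candidate in 10 instructions; an empty list is detected within 3.\<close>

lemma solver_search:
  assumes "array M (R 14) xs" "R 15 = R 14 + length xs"
    and "array M (R 5) ys" "R 4 = R 5 + length ys"
    and "sorted_wrt (<) xs" "sorted_wrt (<) ys"
    and "\<forall>x\<in>set xs. \<forall>y\<in>set ys. x + y < 2 ^ w"
    and "R 15 < B" "R 4 < B" "B \<le> 2 ^ w" "R 0 = 0" "R (Suc 0) = 1" "R 3 = t"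
  shows "halts_within w solver B (10 * (length xs + length ys) + 3)
     \<lparr>pc = 39, regs = R, mem = M\<rparr> (\<exists>x\<in>set xs. \<exists>y\<in>set ys. x + y = t)"
  using assms
proof (induction "length xs + length ys" arbitrary: xs ys R rule: less_induct)
  case less
  note prems = less.prems
  show ?case
  proof (cases "xs = [] \<or> ys = []")
    case True
    then consider "xs = []" | "xs \<noteq> []" "ys = []" by auto
    then have "halts_within w solver B (3 + T) \<lparr>pc = 39, regs = R, mem = M\<rparr>
      (\<exists>x\<in>set xs. \<exists>y\<in>set ys. x + y = t)" for T
      by cases (use prems in \<open>simp_all add: solver_exec\<close>)
    from this[of 0] show ?thesis by (rule halts_within_mono) simp
  next
    case False
    then obtain x xs' where xs: "xs = x # xs'" by (cases xs) auto
    from False obtain y ys' where ys: "ys = ys' @ [y]" by (cases ys rule: rev_cases) auto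
    have M: "M (R 14) = x" "M (R 5 + length ys') = y"
      using prems xs ys by (auto simp: array_append)
    \<comment> \<open>\<open>Op_sub\<close> adds \<open>2 ^ w\<close> before subtracting; the
      reduced result is the address of the last entry of \<open>ys\<close>.\<close>
    have j: "(R 4 + 2 ^ w - 1) mod 2 ^ w = R 5 + length ys'"
    proof -
      have "R 4 + 2 ^ w - 1 = R 5 + length ys' + 2 ^ w" using prems ys by simp
      moreover have "R 5 + length ys' < 2 ^ w" using prems ys by simp
      ultimately show ?thesis by simp
    qed
    have s: "(x + y) mod 2 ^ w = x + y" using prems xs ys by simp
    have bnd: "R 14 < B" "R 5 + length ys' < B" "Suc (R 14) mod 2 ^ w = Suc (R 14)"
      "(R 5 + length ys') mod 2 ^ w = R 5 + length ys'"
      using prems xs ys by simp_all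
    have ne: "R 14 \<noteq> R 15" "R 4 \<noteq> R 5" using prems xs ys by simp_all
    note ex = solver_exec M j[simplified] s bnd ne prems(11-13)
    consider "x + y = t" | "x + y < t" | "t < x + y" by linarith
    then show ?thesis
    proof cases
      case 1
      then have "t mod 2 ^ w = t" using s by simp
      with 1 have "halts_within w solver B (10 + T) \<lparr>pc = 39, regs = R, mem = M\<rparr> True" for T
        by (simp add: ex)
      note halts = this
      have eq: "(\<exists>x\<in>set xs. \<exists>y\<in>set ys. x + y = t) = True"
        using 1 xs ys by auto
      show ?thesis
        unfolding eq by (rule halts_within_mono[OF halts[of 0]]) (simp add: xs)
    next
      case 2
      \<comment> \<open>Even the largest entry \<open>y\<close> of \<open>ys\<close> is too small a
        partner for \<open>x\<close>, so \<open>x\<close> can be discarded.\<close>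
      have eq: "(\<exists>x\<in>set xs. \<exists>y\<in>set ys. x + y = t) = (\<exists>x\<in>set xs'. \<exists>y\<in>set ys. x + y = t)"
        using 2 prems(6) xs ys by (fastforce simp: sorted_wrt_append)
      define T where "T = 10 * (length xs' + length ys) + 3"
      define R' where "R' = R(9 := R 5 + length ys', 13 := y, 12 := x + y, 14 := Suc (R 14))"
      have "halts_within w solver B T
        \<lparr>pc = 39, regs = R', mem = M\<rparr> (\<exists>x\<in>set xs'. \<exists>y\<in>set ys. x + y = t)"
        unfolding T_def by (rule less.hyps) (use prems xs in \<open>auto simp: R'_def\<close>)
      then have "halts_within w solver B (10 + T)
        \<lparr>pc = 39, regs = R, mem = M\<rparr> (\<exists>x\<in>set xs'. \<exists>y\<in>set ys. x + y = t)"
        using 2 by (simp add: ex R'_def)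
      then show ?thesis unfolding eq by (rule halts_within_mono) (simp add: xs T_def)
    next
      case 3
      \<comment> \<open>Even the smallest entry \<open>x\<close> of \<open>xs\<close> is too large a
        partner for \<open>y\<close>, so \<open>y\<close> can be discarded.\<close>
      have eq: "(\<exists>x\<in>set xs. \<exists>y\<in>set ys. x + y = t) = (\<exists>x\<in>set xs. \<exists>y\<in>set ys'. x + y = t)"
        using 3 prems(5) xs ys by fastforce
      define T where "T = 10 * (length xs + length ys') + 3"
      define R' where "R' = R(9 := R 5 + length ys', 13 := y, 12 := x + y, 4 := R 5 + length ys')"
      have "halts_within w solver B T
        \<lparr>pc = 39, regs = R', mem = M\<rparr> (\<exists>x\<in>set xs. \<exists>y\<in>set ys'. x + y = t)"
        unfolding T_def
        by (rule less.hyps) (use prems ys in \<open>auto simp: R'_def array_append sorted_wrt_append\<close>)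
      then have "halts_within w solver B (10 + T)
        \<lparr>pc = 39, regs = R, mem = M\<rparr> (\<exists>x\<in>set xs. \<exists>y\<in>set ys'. x + y = t)"
        using 3 by (simp add: ex R'_def)
      then show ?thesis unfolding eq by (rule halts_within_mono) (simp add: ys T_def)
    qed
  qed
qed

section \<open>The merge loop\<close>

text \<open>\<open>xs\<close> and \<open>ys\<close> are the unread parts of one stored list, hence
  their common end \<open>R 11\<close>; \<open>R 8\<close> is added to \<open>ys\<close> on the fly.
  Each round advances a pointer in at most 11 instructions and writes only from \<open>R 4\<close>
  on, beyond the source. The last hypothesis is a continuation: from any exit state, budget
  \<open>T\<close> suffices for the rest.\<close>

lemma solver_merge:
  assumes "array M (R 9) xs" "R 11 = R 9 + length xs"
    and "array M (R 10) ys" "R 11 = R 10 + length ys"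
    and "R 11 \<le> R 4" "R 4 + length (merge_lists xs (map ((+) (R 8)) ys)) < B" "B \<le> 2 ^ w"
    and "\<forall>y\<in>set ys. R 8 + y < 2 ^ w" "R 0 = 0" "R (Suc 0) = 1"
    and "\<And>R' M'. R' 5 = R 11 \<Longrightarrow> R' 4 = R 4 + length (merge_lists xs (map ((+) (R 8)) ys)) \<Longrightarrow>
      array M' (R 4) (merge_lists xs (map ((+) (R 8)) ys)) \<Longrightarrow>
      \<forall>k<R 4. M' k = M k \<Longrightarrow> \<forall>r\<in>{0, 1, 2, 3, 6, 7, 14, 15}. R' r = R r \<Longrightarrow>
      halts_within w solver B T \<lparr>pc = 11, regs = R', mem = M'\<rparr> b"
  shows "halts_within w solver B (11 * (length xs + length ys) + (3 + T))
     \<lparr>pc = 18, regs = R, mem = M\<rparr> b"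
  using assms
proof (induction "length xs + length ys" arbitrary: xs ys R M rule: less_induct)
  case less
  note prems = less.prems(1-10) and cont = less.prems(11)
  show ?case
  proof (cases ys)
    case Nil
    then have "R 10 = R 11" "R 11 mod 2 ^ w = R 11" using prems by simp_all
    then have "halts_within w solver B (3 + T) \<lparr>pc = 18, regs = R, mem = M\<rparr> b"
      using prems(9) by (simp add: solver_exec) (rule cont; simp add: Nil)
    then show ?thesis by (rule halts_within_mono) simp
  next
    case (Cons y ys')
    define v where "v = R 8 + y"
    define T' where "T' = 11 * (length xs + length ys') + (3 + T)"
    define T1 where "T1 = 4 + T'"
    have y: "M (R 10) = y" "R 10 < B" "R 10 \<noteq> R 11" "Suc (R 10) mod 2 ^ w = Suc (R 10)"
      "(y + R 8) mod 2 ^ w = v"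
      using prems Cons by (simp_all add: v_def add.commute)
    \<comment> \<open>Instruction 25 is reached both when \<open>xs\<close> is exhausted and when
      \<open>v < x\<close>. \<open>R'\<close> may differ from \<open>R\<close> only in the scratch
      registers 12 and 13.\<close>
    have write_y: "halts_within w solver B T1
        \<lparr>pc = 25, regs = R', mem = M\<rparr> b"
      if m: "merge_lists xs (map ((+) (R 8)) ys) = v # merge_lists xs (map ((+) (R 8)) ys')"
        and R': "R' 13 = v" "\<And>r. r \<noteq> 12 \<Longrightarrow> r \<noteq> 13 \<Longrightarrow> R' r = R r" for R'
    proof -
      have "halts_within w solver B T'
        \<lparr>pc = 18, regs = R'(4 := Suc (R 4), 10 := Suc (R 10)), mem = M(R 4 := v)\<rparr> b"
        unfolding T'_def
      proof (rule less.hyps)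
        fix R'' M''
        assume "array M'' ((R'(4 := Suc (R 4), 10 := Suc (R 10))) 4)
            (merge_lists xs (map ((+) ((R'(4 := Suc (R 4), 10 := Suc (R 10))) 8)) ys'))"
          "\<forall>k<(R'(4 := Suc (R 4), 10 := Suc (R 10))) 4. M'' k = (M(R 4 := v)) k"
          "R'' 5 = (R'(4 := Suc (R 4), 10 := Suc (R 10))) 11"
          "R'' 4 = (R'(4 := Suc (R 4), 10 := Suc (R 10))) 4 +
            length (merge_lists xs (map ((+) ((R'(4 := Suc (R 4), 10 := Suc (R 10))) 8)) ys'))"
          "\<forall>r\<in>{0, 1, 2, 3, 6, 7, 14, 15}. R'' r = (R'(4 := Suc (R 4), 10 := Suc (R 10))) r"
        then show "halts_within w solver B T \<lparr>pc = 11, regs = R'', mem = M''\<rparr> b"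
          by (intro cont) (auto simp: R' m)
      qed (use prems in \<open>auto simp: Cons R' m[unfolded Cons, simplified] array_update_above\<close>)
      moreover have "Suc (R 4) mod 2 ^ w = Suc (R 4)" "R 4 < B"
        using prems m by simp_all
      ultimately show ?thesis
        using y prems(9,10) by (simp add: T1_def solver_exec R')
    qed
    show ?thesis
    proof (cases xs)
      case Nil
      then have "R 9 = R 11" using prems by simp
      then have "halts_within w solver B (4 + T1)
        \<lparr>pc = 18, regs = R, mem = M\<rparr> b"
        using y by (simp add: solver_exec) (rule write_y; simp add: Nil Cons v_def)
      then show ?thesis by (rule halts_within_mono) (simp add: Cons T1_def T'_def)
    next
      case xs: (Cons x xs')
      have x: "M (R 9) = x" "R 9 < B" "R 9 \<noteq> R 11" "Suc (R 9) mod 2 ^ w = Suc (R 9)"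
        using prems xs by simp_all
      define T2 where "T2 = 11 * (length xs' + length ys) + (3 + T)"
      consider "x < v" | "x = v" | "v < x" by linarith
      then show ?thesis
      proof cases
        case 1
        then have m: "merge_lists xs (map ((+) (R 8)) ys) = x # merge_lists xs' (map ((+) (R 8)) ys)"
          by (simp add: xs Cons v_def)
        define R' where "R' = R(13 := v, 12 := x, 4 := Suc (R 4), 9 := Suc (R 9))"
        have "halts_within w solver B T2 \<lparr>pc = 18, regs = R', mem = M(R 4 := x)\<rparr> b"
          unfolding T2_def
        proof (rule less.hyps)
          fix R'' M''
          assume "array M'' (R' 4) (merge_lists xs' (map ((+) (R' 8)) ys))"
            "\<forall>k<R' 4. M'' k = (M(R 4 := x)) k" "R'' 5 = R' 11"
            "R'' 4 = R' 4 + length (merge_lists xs' (map ((+) (R' 8)) ys))"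
            "\<forall>r\<in>{0, 1, 2, 3, 6, 7, 14, 15}. R'' r = R' r"
          then show "halts_within w solver B T \<lparr>pc = 11, regs = R'', mem = M''\<rparr> b"
            by (intro cont) (auto simp: R'_def m)
        qed (use prems m in \<open>auto simp: xs R'_def array_update_above\<close>)
        moreover have "Suc (R 4) mod 2 ^ w = Suc (R 4)" "R 4 < B"
          using prems m by simp_all
        ultimately have "halts_within w solver B (10 + T2) \<lparr>pc = 18, regs = R, mem = M\<rparr> b"
          using 1 x y prems(9,10) by (simp add: solver_exec R'_def)
        then show ?thesis by (rule halts_within_mono) (simp add: T2_def xs)
      next
        case 2
        \<comment> \<open>A tie writes nothing and advances only pointer 9; \<open>v\<close> stays
          at the head of the second list.\<close>
        then have m: "merge_lists xs (map ((+) (R 8)) ys) = merge_lists xs' (map ((+) (R 8)) ys)"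
          by (simp add: xs Cons v_def)
        define R' where "R' = R(13 := v, 12 := x, 9 := Suc (R 9))"
        have "halts_within w solver B T2 \<lparr>pc = 18, regs = R', mem = M\<rparr> b"
          unfolding T2_def
        proof (rule less.hyps)
          fix R'' M''
          assume "array M'' (R' 4) (merge_lists xs' (map ((+) (R' 8)) ys))"
            "\<forall>k<R' 4. M'' k = M k" "R'' 5 = R' 11"
            "R'' 4 = R' 4 + length (merge_lists xs' (map ((+) (R' 8)) ys))"
            "\<forall>r\<in>{0, 1, 2, 3, 6, 7, 14, 15}. R'' r = R' r"
          then show "halts_within w solver B T \<lparr>pc = 11, regs = R'', mem = M''\<rparr> b"
            by (intro cont) (auto simp: R'_def m)
        qed (use prems m in \<open>auto simp: xs R'_def\<close>)
        then have "halts_within w solver B (9 + T2) \<lparr>pc = 18, regs = R, mem = M\<rparr> b"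
          using 2 x y prems(9,10) by (simp add: solver_exec R'_def)
        then show ?thesis by (rule halts_within_mono) (simp add: T2_def xs)
      next
        case 3
        have "halts_within w solver B T1 \<lparr>pc = 25, regs = R(13 := v, 12 := x), mem = M\<rparr> b"
          by (rule write_y) (use 3 in \<open>simp_all add: xs Cons v_def\<close>)
        then have "halts_within w solver B (7 + T1) \<lparr>pc = 18, regs = R, mem = M\<rparr> b"
          using 3 x y prems(9,10) by (simp add: solver_exec)
        then show ?thesis by (rule halts_within_mono) (simp add: T1_def T'_def Cons)
      qed
    qed
  qed
qed

section \<open>Enumerating the sums of one half\<close>

text \<open>An element costs 7 instructions of setup and a merge of two lists of length at most
  \<open>U\<close>, which takes \<open>22 * U + 3\<close>; it fills at most \<open>U\<close> new
  cells. The conditions on \<open>R 7\<close> and \<open>R 2\<close> keep the loop from leaving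
  early; the exit itself is left to the continuation.\<close>

lemma solver_build:
  assumes "array M (R 6) zs" "R 6 + length zs \<le> R 5" "array M (R 5) L" "R 4 = R 5 + length L"
    and "sorted_wrt (<) L"
    and "R 7 \<notin> {R 6..<R 6 + length zs}" "R 2 \<notin> {R 6..<R 6 + length zs}"
    and "length (foldl add_elem L zs) \<le> U" "\<forall>v\<in>set (foldl add_elem L zs). v < 2 ^ w"
    and "R 4 + length zs * U < B" "B \<le> 2 ^ w" "R 0 = 0" "R (Suc 0) = 1"
    and "\<And>R' M'. R' 6 = R 6 + length zs \<Longrightarrow> R 5 \<le> R' 5 \<Longrightarrow> array M' (R' 5) (foldl add_elem L zs) \<Longrightarrow>
      R' 4 = R' 5 + length (foldl add_elem L zs) \<Longrightarrow> R' 4 \<le> R 4 + length zs * U \<Longrightarrow>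
      \<forall>k<R 4. M' k = M k \<Longrightarrow> \<forall>r\<in>{0, 1, 2, 3, 7, 14, 15}. R' r = R r \<Longrightarrow>
      halts_within w solver B T \<lparr>pc = 11, regs = R', mem = M'\<rparr> b"
  shows "halts_within w solver B (length zs * (22 * U + 10) + T)
     \<lparr>pc = 11, regs = R, mem = M\<rparr> b"
  using assms
proof (induction zs arbitrary: L R M)
  case Nil
  show ?case using Nil.prems(1-13) by simp (rule Nil.prems(14); simp)
next
  case (Cons a zs)
  note prems = Cons.prems(1-13) and cont = Cons.prems(14)
  define L' where "L' = add_elem L a"
  define T' where "T' = length zs * (22 * U + 10) + T"
  define T1 where "T1 = 11 * (length L + length L) + (3 + T')"
  define R1 where "R1 = R(8 := a, 6 := Suc (R 6), 9 := R 5, 10 := R 5, 11 := R 4)"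
  have sorted: "sorted_wrt (<) L'" using prems by (simp add: L'_def sorted_add_elem)
  have U: "length L \<le> U" "length L' \<le> U"
    using length_foldl_add_elem_mono[OF sorted, of zs]
      length_foldl_add_elem_mono[OF prems(5), of "a # zs"] prems(8) by (simp_all add: L'_def)
  \<comment> \<open>Every sum formed in this round is still an entry of the final list, hence below
    \<open>2 ^ w\<close>: the addition does not wrap around.\<close>
  have "(+) a ` set L \<subseteq> set (foldl add_elem L' zs)"
    using set_foldl_add_elem_mono[OF sorted, of zs] set_add_elem[OF prems(5), of a]
    by (simp add: L'_def)
  then have sums: "\<forall>y\<in>set L. a + y < 2 ^ w" using prems(9) by (auto simp: L'_def)
  have bounds: "R 4 + length L' + length zs * U < B" "R 4 < 2 ^ w" "R 5 < 2 ^ w" "Suc (R 6) < 2 ^ w"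
    "R 6 < B"
    using prems(2,4,10,11) U by simp_all
  have "halts_within w solver B T1 \<lparr>pc = 18, regs = R1, mem = M\<rparr> b"
    unfolding T1_def
  proof (rule solver_merge)
    fix R2 M2
    assume R2: "R2 5 = R1 11" "R2 4 = R1 4 + length (merge_lists L (map ((+) (R1 8)) L))"
      "array M2 (R1 4) (merge_lists L (map ((+) (R1 8)) L))" "\<forall>k<R1 4. M2 k = M k"
      "\<forall>r\<in>{0, 1, 2, 3, 6, 7, 14, 15}. R2 r = R1 r"
    have R2': "R2 5 = R 4" "R2 4 = R 4 + length L'" "array M2 (R 4) L'" "\<forall>k<R 4. M2 k = M k"
      "R2 6 = Suc (R 6)" "\<forall>r\<in>{0, 1, 2, 3, 7, 14, 15}. R2 r = R r"
      using R2 by (simp_all add: R1_def L'_def add_elem_def)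
    \<comment> \<open>The remaining input lies below \<open>R 4\<close>, where the merge changes
      nothing.\<close>
    have "array M2 (Suc (R 6)) zs \<longleftrightarrow> array M (Suc (R 6)) zs"
      by (rule array_cong) (use prems R2' in auto)
    then show "halts_within w solver B T' \<lparr>pc = 11, regs = R2, mem = M2\<rparr> b"
      unfolding T'_def
    proof (intro Cons.IH[where L = L'])
      fix R' M'
      assume "R' 6 = R2 6 + length zs" "R2 5 \<le> R' 5" "array M' (R' 5) (foldl add_elem L' zs)"
        "R' 4 = R' 5 + length (foldl add_elem L' zs)" "R' 4 \<le> R2 4 + length zs * U"
        "\<forall>k<R2 4. M' k = M2 k" "\<forall>r\<in>{0, 1, 2, 3, 7, 14, 15}. R' r = R2 r"
      then show "halts_within w solver B T \<lparr>pc = 11, regs = R', mem = M'\<rparr> b"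
        using R2' U prems(4) by (intro cont) (auto simp: L'_def)
    qed (use prems R2' sorted bounds in \<open>auto simp: L'_def\<close>)
  qed (use prems sums bounds in \<open>auto simp: R1_def L'_def add_elem_def\<close>)
  moreover have "R 6 \<noteq> R 7" "R 6 \<noteq> R 2" "M (R 6) = a" using prems(1,6,7) by auto
  ultimately have "halts_within w solver B (7 + T1) \<lparr>pc = 11, regs = R, mem = M\<rparr> b"
    using bounds prems(12,13) by (simp add: solver_exec R1_def)
  then show ?case by (rule halts_within_mono) (use U in \<open>simp add: T1_def T'_def\<close>)
qed

section \<open>Composing the phases\<close>

lemma array_init_config: "array (mem (init_config xs t)) 2 xs"
  by (simp add: array_iff_nth init_config_def nth_Cons')

text \<open>The phases are verified backwards, each serving as the continuation of the one before:
  search, second half, first half, initialization.\<close>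

lemma solver_halts:
  fixes xs :: "nat list" and t w :: nat
  defines "n \<equiv> length xs" and "h \<equiv> length xs div 2"
  defines "A \<equiv> subset_sums (mset (take h xs))" and "B \<equiv> subset_sums (mset (drop h xs))"
  assumes n: "0 < n" and fits: "fits_words w (mset xs) t (100 * ((card A + card B) * n))"
  shows "halts_within w solver (100 * ((card A + card B) * n)) (100 * (max (card A) (card B) * n))
    (init_config xs t) (subset_sum (mset xs) t)"
proof -
  define S where "S = 100 * ((card A + card B) * n)"
  define ys where "ys = take h xs"
  define zs where "zs = drop h xs"
  define LA where "LA = foldl add_elem [0] ys"
  define LB where "LB = foldl add_elem [0] zs"
  have len: "length ys = h" "length zs = n - h" "h \<le> n" "h < n"
    using n by (auto simp: ys_def zs_def n_def h_def)
  have xs: "xs = ys @ zs" by (simp add: ys_def zs_def)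
  have sets: "set LA = A" "set LB = B"
    by (simp_all add: LA_def LB_def A_def B_def ys_def zs_def set_foldl_add_elem)
  have sorted: "sorted_wrt (<) LA" "sorted_wrt (<) LB"
    by (simp_all add: LA_def LB_def sorted_foldl_add_elem)
  then have card: "length LA = card A" "length LB = card B"
    using sets by (simp_all add: length_sorted_eq_card)
  have pos: "0 < card A" "0 < card B"
    using length_foldl_add_elem_mono[of "[0]" ys] length_foldl_add_elem_mono[of "[0]" zs] card
    by (simp_all add: LA_def LB_def)
  have words: "t < 2 ^ w" "\<Sum>\<^sub># (mset xs) < 2 ^ w" "S \<le> 2 ^ w"
    using fits by (simp_all add: fits_words_def S_def)
  have answer: "subset_sum (mset xs) t \<longleftrightarrow> (\<exists>x\<in>set LA. \<exists>y\<in>set LB. x + y = t)"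
    unfolding sets A_def B_def using subset_sum_union_iff[of "mset (take h xs)" "mset (drop h xs)"]
    by (simp flip: mset_append)
  have sums: "x + y < 2 ^ w" if "x \<in> set LA" "y \<in> set LB" for x y
    using that subset_sums_le[of x "mset ys"] subset_sums_le[of y "mset zs"] words(2)
    by (simp add: xs LA_def LB_def set_foldl_add_elem)
  \<comment> \<open>Paired with the entry 0 of the other list, a single entry inherits the bound on
    pair sums.\<close>
  have zero: "0 \<in> set LA" "0 \<in> set LB"
    using set_foldl_add_elem_mono[of "[0]"] by (simp_all add: LA_def LB_def)
  have fit: "\<forall>v\<in>set LA. v < 2 ^ w" "\<forall>v\<in>set LB. v < 2 ^ w"
    using sums zero by fastforce+
  \<comment> \<open>The input takes \<open>n + 2\<close> cells, each of the two initial lists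
    \<open>[0]\<close> one, and each added element at most \<open>card A\<close> or
    \<open>card B\<close>.\<close>
  have S: "n + 5 + h * card A + (n - h) * card B < S"
  proof -
    have "h * card A \<le> n * card A" "(n - h) * card B \<le> n * card B"
      using len by simp_all
    moreover have "n \<le> n * card A" "1 \<le> n * card A" using pos n by simp_all
    moreover have "S = 100 * (n * card A) + 100 * (n * card B)"
      by (simp add: S_def algebra_simps)
    ultimately show ?thesis by linarith
  qed
  then have small: "n + 5 < S" "n + 5 < 2 ^ w" using words by linarith+
  define M where "M = mem (init_config xs t)"
  have M: "M 0 = n" "M (Suc 0) = t" "array M 2 (ys @ zs)"
    using array_init_config[of xs t] by (simp_all add: M_def init_config_def n_def xs)
  define T3 where "T3 = 10 * (card A + card B) + 3"
  define T2 where "T2 = (n - h) * (22 * card B + 10) + (2 + T3)"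
  define T1 where "T1 = h * (22 * card A + 10) + (8 + T2)"
  \<comment> \<open>Register 7 is 0 and the input pointer is positive, so instruction 11 falls
    through and instruction 12 jumps to the search.\<close>
  have search: "halts_within w solver S (2 + T3) \<lparr>pc = 11, regs = R, mem = M'\<rparr>
      (subset_sum (mset xs) t)"
    if "array M' (R 14) LA" "R 15 = R 14 + card A" "R 15 < S"
      "array M' (R 5) LB" "R 4 = R 5 + card B" "R 4 < S"
      "R 0 = 0" "R (Suc 0) = 1" "R 3 = t" "R 7 = 0" "R 6 = R 2" "0 < R 6" for R M'
  proof -
    have "halts_within w solver S T3 \<lparr>pc = 39, regs = R, mem = M'\<rparr> (subset_sum (mset xs) t)"
      unfolding T3_def answer card[symmetric]
      by (rule solver_search) (use that card sorted sums words in auto)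
    then show ?thesis using that by (simp add: solver_exec)
  qed
  \<comment> \<open>The input pointer is at the mark \<open>2 + h\<close>. Eight instructions save
    the bounds of the first list, clear the mark and store a new \<open>[0]\<close>.\<close>
  have second: "halts_within w solver S (8 + T2) \<lparr>pc = 11, regs = R, mem = M'\<rparr>
      (subset_sum (mset xs) t)"
    if R: "R 6 = 2 + h" "R 7 = 2 + h" "R 2 = n + 2" "n + 2 \<le> R 5" "R 4 = R 5 + card A"
      "R 4 \<le> n + 3 + h * card A" "array M' (R 5) LA" "array M' (2 + h) zs"
      "R 0 = 0" "R (Suc 0) = 1" "R 3 = t" for R M'
  proof -
    define R1 where "R1 = R(14 := R 5, 15 := R 4, 7 := 0, 5 := R 4, 4 := Suc (R 4))"
    define M1 where "M1 = M'(R 4 := 0)"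
    have bounds: "R 4 + 1 + (n - h) * card B < S" "R 4 < S" "R 4 < 2 ^ w" "R 5 < 2 ^ w"
      "Suc (R 4) < 2 ^ w"
      using R S words(3) by linarith+
    have arrays: "array M1 (2 + h) zs" "array M1 (R 5) LA"
      using R card len by (simp_all add: M1_def array_update_above)
    have "halts_within w solver S T2 \<lparr>pc = 11, regs = R1, mem = M1\<rparr> (subset_sum (mset xs) t)"
      unfolding T2_def len(2)[symmetric]
    proof (rule solver_build[where L = "[0]"], fold LB_def)
      fix R2 M2
      assume R2: "R2 6 = R1 6 + length zs" "array M2 (R2 5) LB" "R2 4 = R2 5 + length LB"
        "R2 4 \<le> R1 4 + length zs * card B" "\<forall>k<R1 4. M2 k = M1 k"
        "\<forall>r\<in>{0, 1, 2, 3, 7, 14, 15}. R2 r = R1 r"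
      have "array M2 (R 5) LA \<longleftrightarrow> array M1 (R 5) LA"
        by (rule array_cong) (use R2 R card in \<open>auto simp: R1_def\<close>)
      then show "halts_within w solver S (2 + T3) \<lparr>pc = 11, regs = R2, mem = M2\<rparr>
          (subset_sum (mset xs) t)"
        by (intro search) (use R R2 arrays bounds len card in \<open>auto simp: R1_def\<close>)
    qed (use R arrays bounds len card fit words in \<open>auto simp: R1_def M1_def\<close>)
    then show ?thesis
      using R bounds by (simp add: solver_exec R1_def M1_def)
  qed
  \<comment> \<open>The state after the first 11 instructions, with \<open>[0]\<close> stored right
    behind the input.\<close>
  define R0 where "R0 = (\<lambda>_ :: nat. 0 :: nat)(1 := 1, 3 := t, 6 := 2, 7 := 2 + h, 2 := n + 2,
    5 := n + 2, 4 := Suc (Suc (Suc n)))"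
  define M0 where "M0 = M(n + 2 := 0)"
  have arrays: "array M0 2 ys" "array M0 (2 + h) zs"
    using M(3) len by (simp_all add: M0_def array_append array_update_above)
  have "halts_within w solver S T1 \<lparr>pc = 11, regs = R0, mem = M0\<rparr> (subset_sum (mset xs) t)"
    unfolding T1_def len(1)[symmetric]
  proof (rule solver_build[where L = "[0]"], fold LA_def)
    fix R2 M2
    assume R2: "R2 6 = R0 6 + length ys" "R0 5 \<le> R2 5" "array M2 (R2 5) LA"
      "R2 4 = R2 5 + length LA" "R2 4 \<le> R0 4 + length ys * card A" "\<forall>k<R0 4. M2 k = M0 k"
      "\<forall>r\<in>{0, 1, 2, 3, 7, 14, 15}. R2 r = R0 r"
    have "array M2 (2 + h) zs \<longleftrightarrow> array M0 (2 + h) zs"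
      by (rule array_cong) (use R2 len in \<open>auto simp: R0_def\<close>)
    then show "halts_within w solver S (8 + T2) \<lparr>pc = 11, regs = R2, mem = M2\<rparr>
        (subset_sum (mset xs) t)"
      by (intro second) (use R2 arrays len card in \<open>auto simp: R0_def\<close>)
  qed (use arrays len card fit words S in \<open>auto simp: R0_def M0_def\<close>)
  \<comment> \<open>The constants 1 and 2 and the mark \<open>h + 2\<close> must fit into a word to
    survive reduction modulo \<open>2 ^ w\<close>.\<close>
  moreover have "0 < w" using small(2) by (cases w) simp_all
  moreover have "2 < (2::nat) ^ w" "h + 2 < 2 ^ w" using small len by linarith+
  moreover have "drop_bit (Suc 0) n = h" by (simp add: drop_bit_Suc h_def n_def)
  ultimately have "halts_within w solver S (11 + T1) \<lparr>pc = 0, regs = \<lambda>_. 0, mem = M\<rparr>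
      (subset_sum (mset xs) t)"
    using small M(1,2) by (simp add: solver_exec R0_def M0_def)
  moreover have "init_config xs t = \<lparr>pc = 0, regs = \<lambda>_. 0, mem = M\<rparr>"
    by (simp add: M_def init_config_def)
  \<comment> \<open>With \<open>U\<close> the larger cardinality, the total is at most
    \<open>22 * n * U + 10 * n + 20 * U + 24\<close>, hence at most
    \<open>76 * n * U\<close>.\<close>
  moreover have "11 + T1 \<le> 100 * (max (card A) (card B) * n)"
  proof -
    define U where "U = max (card A) (card B)"
    have U: "card A \<le> U" "card B \<le> U" "1 \<le> U" using pos by (auto simp: U_def)
    define a where "a = h * (22 * card A + 10)"
    define b where "b = (n - h) * (22 * card B + 10)"
    have "a + b \<le> h * (22 * U + 10) + (n - h) * (22 * U + 10)"
      unfolding a_def b_def using U by (intro add_mono mult_le_mono2) simp_all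
    also have "\<dots> = n * (22 * U + 10)"
      using len by (simp flip: add_mult_distrib)
    also have "\<dots> = 22 * (n * U) + 10 * n" by (simp add: algebra_simps)
    finally have "a + b \<le> 22 * (n * U) + 10 * n" .
    moreover have "n \<le> n * U" "U \<le> n * U" "1 \<le> n * U" using U n by simp_all
    moreover have "11 + T1 = a + b + 10 * card A + 10 * card B + 24"
      by (simp add: T1_def T2_def T3_def a_def b_def)
    ultimately have "11 + T1 \<le> 100 * (n * U)"
      using U by linarith
    then show ?thesis by (simp add: U_def mult.commute)
  qed
  ultimately show ?thesis
    unfolding S_def by (metis halts_within_mono)
qed

text \<open>Both bounds are symmetric in \<open>U0\<close> and \<open>U1\<close>, which covers
  either naming of the halves.\<close>

corollary solver_correct:
  fixes xs :: "nat list" and l0 l1 :: "nat multiset"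
  defines "n \<equiv> length xs" and "U0 \<equiv> card (subset_sums l0)" and "U1 \<equiv> card (subset_sums l1)"
  assumes "0 < n" "halves xs l0 l1" "fits_words w (mset xs) t (100 * ((U0 + U1) * n))"
  shows "outputs w solver \<omega> (init_config xs t) (subset_sum (mset xs) t)"
    and "run_time w solver \<omega> (init_config xs t) \<le> enat (100 * (max U0 U1 * n))"
    and "run_space w solver \<omega> (init_config xs t) \<le> enat (100 * ((U0 + U1) * n))"
proof -
  have "halts_within w solver (100 * ((U0 + U1) * n)) (100 * (max U0 U1 * n))
      (init_config xs t) (subset_sum (mset xs) t)"
    using solver_halts[of xs w t] assms
    by (auto simp: halves_def Let_def add.commute max.commute)
  note halts_within_run[OF deterministic_solver this]
  then show "outputs w solver \<omega> (init_config xs t) (subset_sum (mset xs) t)"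
    and "run_time w solver \<omega> (init_config xs t) \<le> enat (100 * (max U0 U1 * n))"
    and "run_space w solver \<omega> (init_config xs t) \<le> enat (100 * ((U0 + U1) * n))"
    by auto
qed

section \<open>The deterministic and the expected bounds\<close>

lemma prob_space_random_tape: "prob_space (random_tape w)"
  unfolding random_tape_def by (intro prob_space_PiM prob_space_measure_pmf)

theorem theorem4:
  "(\<exists>P c. deterministic P \<and>
     (\<forall>(S :: nat multiset) (l0 :: nat multiset) (l1 :: nat multiset) t n U0 U1 xs w \<omega>.
        (\<forall>a\<in>#S. 0 < a) \<and> 0 < t \<and> n = size S \<and> 0 < n \<and>
        mset xs = S \<and> halves xs l0 l1 \<and>
        U0 = card (subset_sums l0) \<and> U1 = card (subset_sums l1) \<and>
        fits_words w S t (c * ((U0 + U1) * n)) \<longrightarrow>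
        outputs w P \<omega> (init_config xs t) (subset_sum S t) \<and>
        run_time w P \<omega> (init_config xs t) \<le> enat (c * (max U0 U1 * n\<^sup>2)) \<and>
        run_space w P \<omega> (init_config xs t) \<le> enat (c * ((U0 + U1) * n)))) \<and>
   (\<exists>P c.
     (\<forall>(S :: nat multiset) (l0 :: nat multiset) (l1 :: nat multiset) t n U0 U1 xs w.
        (\<forall>a\<in>#S. 0 < a) \<and> 0 < t \<and> n = size S \<and> 0 < n \<and>
        mset xs = S \<and> halves xs l0 l1 \<and>
        U0 = card (subset_sums l0) \<and> U1 = card (subset_sums l1) \<and>
        fits_words w S t (c * ((U0 + U1) * n)) \<longrightarrow>
        (AE \<omega> in random_tape w. outputs w P \<omega> (init_config xs t) (subset_sum S t)) \<and>
        (\<integral>\<^sup>+\<omega>. ennreal_of_enat (run_time w P \<omega> (init_config xs t)) \<partial>random_tape w)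
          \<le> of_nat (c * (max U0 U1 * n)) \<and>
        (AE \<omega> in random_tape w.
           run_space w P \<omega> (init_config xs t) \<le> enat (c * ((U0 + U1) * n)))))"
proof (intro conjI, goal_cases)
  case 1
  show ?case
  proof (rule exI[of _ solver], rule exI[of _ 100], intro conjI allI impI deterministic_solver;
      elim conjE; hypsubst_thin)
    fix l0 l1 :: "nat multiset" and t xs w \<omega>
    assume a: "0 < size (mset xs)" "halves xs l0 l1" "fits_words w (mset xs) t
      (100 * ((card (subset_sums l0) + card (subset_sums l1)) * size (mset xs)))"
    note correct = solver_correct[of xs l0 l1 w t \<omega>, OF a[simplified size_mset]]
    show "outputs w solver \<omega> (init_config xs t) (subset_sum (mset xs) t)"
      by (rule correct)
    show "run_space w solver \<omega> (init_config xs t)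
        \<le> enat (100 * ((card (subset_sums l0) + card (subset_sums l1)) * size (mset xs)))"
      using correct(3) by simp
    \<comment> \<open>The bound linear in \<open>n\<close> is weakened to the quadratic one.\<close>
    have "length xs \<le> (length xs)\<^sup>2" using a(1) by (intro self_le_power) (simp_all add: Suc_le_eq)
    then show "run_time w solver \<omega> (init_config xs t)
        \<le> enat (100 * (max (card (subset_sums l0)) (card (subset_sums l1)) * (size (mset xs))\<^sup>2))"
      by (intro order_trans[OF correct(2)]) simp
  qed
next
  case 2
  show ?case
  proof (rule exI[of _ solver], rule exI[of _ 100], intro conjI allI impI;
      elim conjE; hypsubst_thin)
    fix l0 l1 :: "nat multiset" and t xs w
    assume a: "0 < size (mset xs)" "halves xs l0 l1" "fits_words w (mset xs) t
      (100 * ((card (subset_sums l0) + card (subset_sums l1)) * size (mset xs)))"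
    note correct = solver_correct[of xs l0 l1 w t, OF a[simplified size_mset]]
    interpret prob_space "random_tape w" by (rule prob_space_random_tape)
    show "AE \<omega> in random_tape w. outputs w solver \<omega> (init_config xs t) (subset_sum (mset xs) t)"
      using correct(1) by simp
    show "AE \<omega> in random_tape w. run_space w solver \<omega> (init_config xs t)
        \<le> enat (100 * ((card (subset_sums l0) + card (subset_sums l1)) * size (mset xs)))"
      using correct(3) by simp
    define N where "N = 100 * (max (card (subset_sums l0)) (card (subset_sums l1)) * length xs)"
    \<comment> \<open>The time bound holds on every tape, so the expectation is at most the integral
      of a constant over a probability space.\<close>
    have "(\<integral>\<^sup>+\<omega>. ennreal_of_enat (run_time w solver \<omega> (init_config xs t)) \<partial>random_tape w)
        \<le> (\<integral>\<^sup>+\<omega>. of_nat N \<partial>random_tape w)"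
      using correct(2) ennreal_of_enat_le_iff[of _ "enat N"]
      by (intro nn_integral_mono) (simp add: N_def)
    also have "\<dots> = of_nat N" by (simp add: emeasure_space_1)
    finally show "(\<integral>\<^sup>+\<omega>. ennreal_of_enat (run_time w solver \<omega> (init_config xs t)) \<partial>random_tape w)
        \<le> of_nat (100 * (max (card (subset_sums l0)) (card (subset_sums l1)) * size (mset xs)))"
      by (simp add: N_def)
  qed
qed

end
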